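(* Let $\mathbf A\in\mathbb R^{n\times n}$ be symmetric positive semidefinite with $\|\mathbf A\|_\infty\le1$ and eigenvalues $\lambda_1(\mathbf A)\ge\dots\ge\lambda_n(\mathbf A)$, and let $\epsilon,\delta\in(0,1)$. Let $0<s\le n$ and let $S$ be a random subset of $[n]$ formed by including each index independently with probability $s/n$. Let $\mathbf A_S$ be the corresponding principal submatrix of $\mathbf A$, with eigenvalues $\lambda_1(\mathbf A_S)\ge\dots\ge\lambda_{|S|}(\mathbf A_S)$. For all $i\in[|S|]$ with $\lambda_i(\mathbf A_S)\ge0$, let $\tilde\lambda_i(\mathbf A)=\frac ns\lambda_i(\mathbf A_S)$. For all other $i\in[n]$, let $\tilde\lambda_i(\mathbf A)=0$. If $s\ge\frac{2}{\epsilon^2\delta}$, then with probability at least $1-\delta$, $$\left(\sum_{i=1}^n|\tilde\lambda_i(\mathbf A)-\lambda_i(\mathbf A)|^2\right)^{1/2}\le\epsilon n,$$ which implies that for all $i\in[n]$, $\lambda_i(\mathbf A)-\epsilon n\le\tilde\lambda_i(\mathbf A)\le\lambda_i(\mathbf A)+\epsilon n$.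
   Context: $[n]=\{1,\dots,n\}$. $\|\mathbf A\|_\infty$ is the largest magnitude of an entry of $\mathbf A$. $\mathbf A_S$ is the principal submatrix with rows and columns indexed by $S$. *)

theory Defs
  imports
    "HOL-Probability.Product_PMF"
    "Jordan_Normal_Form.Char_Poly"
    "Jordan_Normal_Form.DL_Submatrix"
begin

definition psd_mat :: "real mat \<Rightarrow> bool" where
  "psd_mat A \<longleftrightarrow> square_mat A \<and> transpose_mat A = A \<and>
     (\<forall>v \<in> carrier_vec (dim_row A). v \<bullet> (A *\<^sub>v v) \<ge> 0)"

definition max_entry_norm :: "real mat \<Rightarrow> real" where
  "max_entry_norm A = Max (abs ` elements_mat A)"

(* proots gives the real roots with multiplicity, so for a symmetric n x n matrix the list has
   length n. The eigenvalues are numbered from 1, as is customary. *)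
definition eigs :: "real mat \<Rightarrow> real list" where
  "eigs A = rev (sorted_list_of_multiset (proots (char_poly A)))"

definition eig :: "real mat \<Rightarrow> nat \<Rightarrow> real" where
  "eig A i = eigs A ! (i - 1)"

(* Rows and columns of matrices are numbered from 0, so index sets are subsets of {..<n}. *)
definition random_subset :: "nat \<Rightarrow> real \<Rightarrow> nat set pmf" where
  "random_subset n p =
     map_pmf (\<lambda>f. {i \<in> {..<n}. f i}) (Pi_pmf {..<n} False (\<lambda>_. bernoulli_pmf p))"

definition est_eig :: "real mat \<Rightarrow> real \<Rightarrow> nat set \<Rightarrow> nat \<Rightarrow> real" where
  "est_eig A s S i =
     (if i \<in> {1..card S} \<and> eig (submatrix A S S) i \<ge> 0
      then real (dim_row A) / s * eig (submatrix A S S) i else 0)"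

definition eig_l2_error :: "real mat \<Rightarrow> real \<Rightarrow> nat set \<Rightarrow> real" where
  "eig_l2_error A s S =
     sqrt (\<Sum>i = 1..dim_row A. \<bar>est_eig A s S i - eig A i\<bar>\<^sup>2)"

end

theory Submission
  imports Defs
begin

text \<open>
  Write \<open>A = B\<^sup>T B\<close> with \<open>B = \<Lambda>\<^sup>1\<^sup>/\<^sup>2 V\<^sup>T\<close>, where \<open>A = V \<Lambda> V\<^sup>T\<close>, so that \<open>B B\<^sup>T = \<Lambda>\<close>. If \<open>B\<^sub>S\<close> consists of the
  columns of \<open>B\<close> with index in \<open>S\<close>, then \<open>A\<^sub>S = B\<^sub>S\<^sup>T B\<^sub>S\<close> has the same spectrum as \<open>B\<^sub>S B\<^sub>S\<^sup>T\<close>, up to zeros.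
  By the Hoffman-Wielandt inequality, the squared error is at most the squared Frobenius norm of
  \<open>(n/s) B\<^sub>S B\<^sub>S\<^sup>T - \<Lambda>\<close>, a sum of independent centred rank-one matrices over the columns of \<open>B\<close>. Its
  expectation is \<open>(n/s - 1) (\<Sum>i. A\<^sub>i\<^sub>i\<^sup>2) \<le> n\<^sup>2/s\<close>, and Markov's inequality concludes.
\<close>

section \<open>Hoffman-Wielandt inequality against a diagonal matrix\<close>

lemma sum_of_bool_delta:
  fixes g :: "nat \<Rightarrow> real"
  assumes "i < n"
  shows "(\<Sum>k<n. of_bool (i = k) * g k) = g i" "(\<Sum>k<n. of_bool (k = i) * g k) = g i"
proof -
  have "of_bool (i = k) * g k = (if i = k then g k else 0)" "of_bool (k = i) * g k = (if k = i then g k else 0)" for k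
    by auto
  then show "(\<Sum>k<n. of_bool (i = k) * g k) = g i" "(\<Sum>k<n. of_bool (k = i) * g k) = g i"
    using assms by (simp_all only:) simp_all
qed

text \<open>For decreasing sequences the identity matrix is a cheapest transport plan under
  quadratic cost. The certificate is a pair of potentials whose sum stays below the cost everywhere
  and meets it on the diagonal; summed against \<open>P\<close>, whose margins are all 1, they give
  the inequality.\<close>

lemma sum_sq_diff_le_doubly_stochastic:
  fixes x y :: "nat \<Rightarrow> real"
  assumes x: "\<And>i j. i \<le> j \<Longrightarrow> j < n \<Longrightarrow> x j \<le> x i"
    and y: "\<And>i j. i \<le> j \<Longrightarrow> j < n \<Longrightarrow> y j \<le> y i"
    and nonneg: "\<And>i j. i < n \<Longrightarrow> j < n \<Longrightarrow> P i j \<ge> 0"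
    and rows: "\<And>i. i < n \<Longrightarrow> (\<Sum>j<n. P i j) = 1"
    and cols: "\<And>j. j < n \<Longrightarrow> (\<Sum>i<n. P i j) = 1"
  shows "(\<Sum>i<n. (x i - y i)\<^sup>2) \<le> (\<Sum>i<n. \<Sum>j<n. P i j * (x i - y j)\<^sup>2)"
proof -
  \<comment> \<open>Optimality of the identity coupling, by linear programming duality: \<open>p\<close> and \<open>q\<close> are dual potentials.\<close>
  define u where "u i = (\<Sum>k<i. (x (Suc k) - x k) * y k)" for i
  define p where "p i = (x i)\<^sup>2 - 2 * u i" for i
  define q where "q j = (y j)\<^sup>2 - 2 * x j * y j + 2 * u j" for j
  \<comment> \<open>\<open>u\<close> is a discrete integral of \<open>y\<close> against the
    increments of \<open>x\<close>. These are nonpositive, so putting the left-end value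
    \<open>y j\<close>, the largest one, in place of the running value can only decrease the
    sum.\<close>
  have up: "x (j + d) * y j - x j * y j \<le> u (j + d) - u j" if "j + d < n" for j d
    using that
  proof (induction d)
    case (Suc d)
    have "(x (j + d) - x (Suc (j + d))) * y (j + d) \<le> (x (j + d) - x (Suc (j + d))) * y j"
      using x[of "j + d" "Suc (j + d)"] y[of j "j + d"] Suc.prems by (intro mult_left_mono) auto
    then show ?case using Suc by (simp add: u_def algebra_simps)
  qed simp
  \<comment> \<open>Here the constant value of \<open>y\<close> belongs to the right end and moves
    with \<open>d\<close>. Hence two comparisons: one lowers the constant in the old part, the other
    drops the last increment.\<close>
  have down: "x i * y (i + d) - x (i + d) * y (i + d) \<le> u i - u (i + d)" if "i + d < n" for i d
    using that
  proof (induction d)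
    case (Suc d)
    have "(x i - x (i + d)) * y (i + Suc d) \<le> (x i - x (i + d)) * y (i + d)"
      using x[of i "i + d"] y[of "i + d" "i + Suc d"] Suc.prems by (intro mult_left_mono) auto
    moreover have "(x (i + d) - x (i + Suc d)) * y (i + Suc d) \<le> (x (i + d) - x (i + Suc d)) * y (i + d)"
      using x[of "i + d" "i + Suc d"] y[of "i + d" "i + Suc d"] Suc.prems by (intro mult_left_mono) auto
    ultimately show ?case using Suc by (simp add: u_def algebra_simps)
  qed simp
  have pot: "p i + q j \<le> (x i - y j)\<^sup>2" if "i < n" "j < n" for i j
  proof -
    have "x i * y j - x j * y j \<le> u i - u j"
    proof (cases "j \<le> i")
      case True
      then show ?thesis using up[of j "i - j"] that by simp
    next
      case False
      then show ?thesis using down[of i "j - i"] that by simp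
    qed
    then show ?thesis by (simp add: p_def q_def power2_eq_square algebra_simps)
  qed
  have "(\<Sum>i<n. (x i - y i)\<^sup>2) = (\<Sum>i<n. p i) + (\<Sum>j<n. q j)"
    unfolding sum.distrib[symmetric]
    by (intro sum.cong) (simp_all add: p_def q_def power2_eq_square algebra_simps)
  also have "\<dots> = (\<Sum>i<n. p i * (\<Sum>j<n. P i j)) + (\<Sum>j<n. q j * (\<Sum>i<n. P i j))"
    using rows cols by simp
  also have "\<dots> = (\<Sum>i<n. \<Sum>j<n. P i j * p i) + (\<Sum>i<n. \<Sum>j<n. P i j * q j)"
    by (simp add: sum_distrib_left mult.commute sum.swap[of "\<lambda>i j. q j * P i j"])
  also have "\<dots> = (\<Sum>i<n. \<Sum>j<n. P i j * (p i + q j))"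
    by (simp add: sum.distrib distrib_left)
  also have "\<dots> \<le> (\<Sum>i<n. \<Sum>j<n. P i j * (x i - y j)\<^sup>2)"
    by (intro sum_mono mult_left_mono pot nonneg) auto
  finally show ?thesis .
qed

text \<open>Multiplying \<open>X - Y\<close> by the orthogonal \<open>V\<close> from the right keeps
  the Frobenius norm, and since \<open>Y V = V diag(y)\<close> the entries of the product are
  \<open>(x i - y j) * V i j\<close>. The squares \<open>(V i j)^2\<close> form a doubly stochastic
  matrix, so the transport inequality applies.\<close>

lemma hoffman_wielandt_diagonal:
  fixes x y :: "nat \<Rightarrow> real" and V Y :: "nat \<Rightarrow> nat \<Rightarrow> real"
  assumes x: "\<And>i j. i \<le> j \<Longrightarrow> j < n \<Longrightarrow> x j \<le> x i"
    and y: "\<And>i j. i \<le> j \<Longrightarrow> j < n \<Longrightarrow> y j \<le> y i"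
    and rows: "\<And>i j. i < n \<Longrightarrow> j < n \<Longrightarrow> (\<Sum>k<n. V i k * V j k) = of_bool (i = j)"
    and cols: "\<And>i j. i < n \<Longrightarrow> j < n \<Longrightarrow> (\<Sum>k<n. V k i * V k j) = of_bool (i = j)"
    and Y: "\<And>i j. i < n \<Longrightarrow> j < n \<Longrightarrow> Y i j = (\<Sum>k<n. V i k * y k * V j k)"
  shows "(\<Sum>i<n. (x i - y i)\<^sup>2) \<le> (\<Sum>i<n. \<Sum>j<n. (of_bool (i = j) * x i - Y i j)\<^sup>2)"
proof -
  define E where "E i t = of_bool (i = t) * x i - Y i t" for i t
  have EV: "(\<Sum>t<n. E i t * V t j) = (x i - y j) * V i j" if i: "i < n" and j: "j < n" for i j
  proof -
    have "(\<Sum>t<n. Y i t * V t j) = (\<Sum>t<n. \<Sum>k<n. V i k * y k * (V t k * V t j))"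
      using i by (simp add: Y sum_distrib_left sum_distrib_right mult_ac)
    also have "\<dots> = (\<Sum>k<n. V i k * y k * (\<Sum>t<n. V t k * V t j))"
      by (subst sum.swap) (simp add: sum_distrib_left)
    also have "\<dots> = (\<Sum>k<n. V i k * y k * of_bool (k = j))"
      using cols j by simp
    also have "\<dots> = V i j * y j"
      using j by (simp add: of_bool_def if_distrib cong: if_cong)
    finally have "(\<Sum>t<n. Y i t * V t j) = V i j * y j" .
    moreover have "(\<Sum>t<n. of_bool (i = t) * x i * V t j) = x i * V i j"
      using i by (simp add: of_bool_def if_distrib if_distribR cong: if_cong)
    ultimately show ?thesis
      by (simp add: E_def algebra_simps sum_subtractf)
  qed
  have norm: "(\<Sum>j<n. (\<Sum>t<n. E i t * V t j)\<^sup>2) = (\<Sum>t<n. (E i t)\<^sup>2)" for i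
  proof -
    have "(\<Sum>j<n. (\<Sum>t<n. E i t * V t j)\<^sup>2)
        = (\<Sum>j<n. \<Sum>t<n. \<Sum>t'<n. E i t * E i t' * (V t j * V t' j))"
      by (simp add: power2_eq_square sum_product mult_ac)
    also have "\<dots> = (\<Sum>t<n. \<Sum>j<n. \<Sum>t'<n. E i t * E i t' * (V t j * V t' j))"
      by (rule sum.swap)
    also have "\<dots> = (\<Sum>t<n. \<Sum>t'<n. \<Sum>j<n. E i t * E i t' * (V t j * V t' j))"
      by (intro sum.cong refl sum.swap)
    also have "\<dots> = (\<Sum>t<n. \<Sum>t'<n. E i t * E i t' * of_bool (t = t'))"
      using rows by (simp add: sum_distrib_left[symmetric])
    also have "\<dots> = (\<Sum>t<n. (E i t)\<^sup>2)"
      by (intro sum.cong) (simp_all add: power2_eq_square of_bool_def if_distrib cong: if_cong)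
    finally show ?thesis .
  qed
  have "(\<Sum>i<n. (x i - y i)\<^sup>2) \<le> (\<Sum>i<n. \<Sum>j<n. (V i j)\<^sup>2 * (x i - y j)\<^sup>2)"
    using x y rows cols
    by (intro sum_sq_diff_le_doubly_stochastic) (simp_all add: power2_eq_square)
  also have "\<dots> = (\<Sum>i<n. \<Sum>j<n. (\<Sum>t<n. E i t * V t j)\<^sup>2)"
    by (simp add: EV power_mult_distrib mult.commute)
  also have "\<dots> = (\<Sum>i<n. \<Sum>t<n. (E i t)\<^sup>2)"
    by (simp add: norm)
  finally show ?thesis by (simp add: E_def)
qed

section \<open>Orthogonal diagonalization of real symmetric matrices\<close>

text \<open>The reflection in the hyperplane orthogonal to \<open>u - e0\<close>, with
  \<open>e0\<close> the first unit vector, swaps \<open>e0\<close> and \<open>u\<close>. A symmetric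
  involution is its own transpose and inverse, so conjugating by it preserves symmetry and
  spectrum.\<close>

lemma householder_reflection:
  fixes u :: "real vec"
  assumes u: "u \<in> carrier_vec n" and norm: "(\<Sum>i<n. (u $ i)\<^sup>2) = 1"
  shows "\<exists>H \<in> carrier_mat n n. transpose_mat H = H \<and> H * H = 1\<^sub>m n \<and> col H 0 = u"
proof -
  have n: "0 < n" using norm by (cases n) auto
  define w where "w i = u $ i - of_bool (i = 0)" for i
  define N where "N = (\<Sum>k<n. (w k)\<^sup>2)"
  define c where "c = 2 / N"  \<comment> \<open>\<open>N = 0\<close> means that \<open>u\<close> is the first unit vector; then \<open>c = 0\<close> and \<open>H\<close> is the identity\<close>
  define H where "H = mat n n (\<lambda>(i,j). of_bool (i = j) - c * w i * w j)"
  have H: "H \<in> carrier_mat n n" by (simp add: H_def)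
  \<comment> \<open>As \<open>u\<close> and \<open>e0\<close> are unit vectors, the squared length
    of their difference is \<open>2 - 2 * u $ 0\<close>. Therefore \<open>w 0 = 0\<close> forces
    \<open>w\<close> to vanish.\<close>
  have "N = (\<Sum>k<n. (u $ k)\<^sup>2 - of_bool (k = 0) * (2 * u $ k - 1))"
    unfolding N_def w_def by (intro sum.cong) (auto simp: power2_eq_square algebra_simps)
  also have "\<dots> = 1 - (2 * u $ 0 - 1)"
    unfolding sum_subtractf norm sum_of_bool_delta(2)[OF n] ..
  finally have N: "N = - 2 * w 0" by (simp add: w_def)
  \<comment> \<open>This is what cancels the quadratic terms of \<open>H * H\<close>. For
    \<open>N = 0\<close> both sides are 0, because division by zero yields 0.\<close>
  have cc: "c * c * N = 2 * c" by (simp add: c_def)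
  have "H * H = 1\<^sub>m n"
  proof (rule eq_matI)
    fix i j assume "i < dim_row (1\<^sub>m n :: real mat)" "j < dim_col (1\<^sub>m n :: real mat)"
    then have i: "i < n" and j: "j < n" by auto
    have "(H * H) $$ (i, j) = (\<Sum>k<n. H $$ (i, k) * H $$ (k, j))"
      using i j by (simp add: H_def scalar_prod_def atLeast0LessThan)
    also have "\<dots> = (\<Sum>k<n. of_bool (i = k) * of_bool (k = j) - of_bool (i = k) * (c * w k * w j)
        - of_bool (k = j) * (c * w i * w k) + c * c * w i * w j * (w k)\<^sup>2)"
      by (intro sum.cong) (use i j in \<open>auto simp: H_def algebra_simps power2_eq_square\<close>)
    also have "\<dots> = of_bool (i = j) - c * w i * w j - c * w i * w j + c * c * w i * w j * N"
      unfolding sum.distrib sum_subtractf sum_of_bool_delta(1)[OF i] sum_of_bool_delta(2)[OF j]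
        N_def sum_distrib_left ..
    also have "\<dots> = of_bool (i = j) + w i * w j * (c * c * N - 2 * c)"
      by (simp add: algebra_simps)
    finally show "(H * H) $$ (i, j) = 1\<^sub>m n $$ (i, j)"
      unfolding cc using i j by simp
  qed (use H in auto)
  moreover have "transpose_mat H = H"
    by (rule eq_matI) (auto simp: H_def)
  moreover have "col H 0 = u"
  proof (rule eq_vecI)
    fix i assume "i < dim_vec u"
    then have i: "i < n" using u by auto
    have "c * w i * w 0 = - w i"
    proof (cases "w 0 = 0")
      case True
      then have "(\<Sum>k<n. (w k)\<^sup>2) = 0" using N N_def by simp
      then have "\<forall>k\<in>{..<n}. (w k)\<^sup>2 = 0" by (subst (asm) sum_nonneg_eq_0_iff) auto
      then have "w i = 0" using i by simp
      then show ?thesis by simp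
    next
      case False
      then show ?thesis by (simp add: c_def N)
    qed
    moreover have "H $$ (i, 0) = of_bool (i = 0) - c * w i * w 0"
      unfolding H_def using i n by simp
    ultimately have "H $$ (i, 0) = u $ i" by (simp add: w_def)
    then show "col H 0 $ i = u $ i" using H i n by simp
  qed (use u H in auto)
  ultimately show ?thesis using H by blast
qed

text \<open>Deflation: a reflection moves a unit eigenvector for the first root to the first axis,
  symmetry makes the conjugated matrix block diagonal, and cancelling a linear factor leaves the
  remaining roots to the smaller block. The list \<open>es\<close> is a parameter so that the order
  of the eigenvalues on the diagonal can be prescribed.\<close>

lemma real_symmetric_spectral:
  fixes A :: "real mat"
  assumes "A \<in> carrier_mat n n" "transpose_mat A = A"
    and "char_poly A = (\<Prod>a\<leftarrow>es. [:- a, 1:])"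
  shows "\<exists>V \<in> carrier_mat n n. transpose_mat V * V = 1\<^sub>m n \<and> V * transpose_mat V = 1\<^sub>m n
           \<and> A = V * mat_diag n (\<lambda>i. es ! i) * transpose_mat V"
  using assms
proof (induction es arbitrary: n A)
  case Nil
  then have "n = 0" using degree_monic_char_poly[of A n] by simp
  with Nil.prems show ?case by (intro bexI[of _ "1\<^sub>m n"]) auto
next
  case (Cons e es)
  note A = Cons.prems(1) and sym = Cons.prems(2) and cp = Cons.prems(3)
  have "degree (char_poly A) = Suc (length es)"
    unfolding cp using degree_linear_factors[of uminus "e # es"] by simp
  then obtain m where n: "n = Suc m" and m: "length es = m"
    using degree_monic_char_poly[OF A] by simp
  have "poly (char_poly A) e = 0" by (simp add: cp)
  then obtain v where v: "v \<in> carrier_vec n" "v \<noteq> 0\<^sub>v n" "A *\<^sub>v v = e \<cdot>\<^sub>v v"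
    using A by (auto simp: eigenvalue_root_char_poly[OF A, symmetric] eigenvalue_def eigenvector_def)
  define N where "N = (\<Sum>i<n. (v $ i)\<^sup>2)"
  have "\<exists>i<n. v $ i \<noteq> 0" using v(1,2) by (metis carrier_vecD eq_vecI index_zero_vec)
  then have N: "N > 0" unfolding N_def by (auto intro: sum_pos2)
  define u where "u = (1 / sqrt N) \<cdot>\<^sub>v v"
  have u: "u \<in> carrier_vec n" using v by (simp add: u_def)
  have Au: "A *\<^sub>v u = e \<cdot>\<^sub>v u"
    using v A by (simp add: u_def mult_mat_vec smult_smult_assoc mult.commute)
  have "(\<Sum>i<n. (u $ i)\<^sup>2) = (\<Sum>i<n. (v $ i)\<^sup>2 / N)"
    using v N by (intro sum.cong) (auto simp: u_def power_divide)
  also have "\<dots> = 1" using N by (simp add: N_def flip: sum_divide_distrib)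
  finally obtain H where H: "H \<in> carrier_mat n n" "transpose_mat H = H" "H * H = 1\<^sub>m n" "col H 0 = u"
    using householder_reflection[OF u] by blast
  define M where "M = H * A * H"
  have M: "M \<in> carrier_mat n n" using H A by (simp add: M_def)
  have symM: "transpose_mat M = M"
    using H A sym by (simp add: M_def transpose_mult[of _ n n _ n] assoc_mult_mat[of _ n n _ n _ n])
  have "M = H * (A * H)" using H A by (simp add: M_def)
  \<comment> \<open>\<open>H\<close> sends the first unit vector to \<open>u\<close> and, being an
    involution, sends \<open>u\<close> back; in between, \<open>A\<close> only multiplies by
    \<open>e\<close>.\<close>
  then have "col M 0 = H *\<^sub>v (A *\<^sub>v u)"
    using H(4) col_mult2[OF H(1) mult_carrier_mat[OF A H(1)], of 0] col_mult2[OF A H(1), of 0] n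
    by simp
  also have "\<dots> = e \<cdot>\<^sub>v (H *\<^sub>v u)" using Au H u by (simp add: mult_mat_vec)
  also have "H *\<^sub>v u = col (H * H) 0"
    using H(4) col_mult2[OF H(1) H(1), of 0] n by simp
  also have "\<dots> = unit_vec n 0" using H n by simp
  finally have colM: "col M 0 = e \<cdot>\<^sub>v unit_vec n 0" .
  have M0: "M $$ (i, 0) = (if i = 0 then e else 0)" if "i < n" for i
    using arg_cong[OF colM, of "\<lambda>x. x $ i"] that M n by auto
  have M0': "M $$ (0, i) = (if i = 0 then e else 0)" if "i < n" for i
    using M0[OF that] arg_cong[OF symM, of "\<lambda>x. x $$ (i, 0)"] that M n by auto
  define A' where "A' = mat m m (\<lambda>(i,j). M $$ (Suc i, Suc j))"
  have A': "A' \<in> carrier_mat m m" by (simp add: A'_def)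
  have symA': "transpose_mat A' = A'"
  proof (rule eq_matI)
    fix i j assume "i < dim_row A'" "j < dim_col A'"
    then have "i < m" "j < m" by (auto simp: A'_def)
    then show "transpose_mat A' $$ (i, j) = A' $$ (i, j)"
      using arg_cong[OF symM, of "\<lambda>x. x $$ (Suc i, Suc j)"] M n by (simp add: A'_def)
  qed (auto simp: A'_def)
  have MB: "M = four_block_mat (mat 1 1 (\<lambda>_. e)) (0\<^sub>m 1 m) (0\<^sub>m m 1) A'"
    by (rule eq_matI) (use M n in \<open>auto simp: M0 M0' A'_def\<close>)
  have "char_poly M = char_poly A"
  proof (rule char_poly_similar, rule similar_matI)
    show "{M, A, H, H} \<subseteq> carrier_mat n n" using M A H by auto
  qed (use H M_def in auto)
  moreover have "char_poly M = [:- e, 1:] * char_poly A'"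
    unfolding MB by (subst char_poly_four_block_zeros_col) (auto simp: A' char_poly_def char_poly_matrix_def det_single)
  ultimately have "[:- e, 1:] * char_poly A' = [:- e, 1:] * (\<Prod>a\<leftarrow>es. [:- a, 1:])"
    by (simp add: cp)
  then have "char_poly A' = (\<Prod>a\<leftarrow>es. [:- a, 1:])" by (subst (asm) mult_cancel_left) simp
  from Cons.IH[OF A' symA' this] obtain V' where V': "V' \<in> carrier_mat m m"
    "transpose_mat V' * V' = 1\<^sub>m m" "V' * transpose_mat V' = 1\<^sub>m m"
    "A' = V' * mat_diag m ((!) es) * transpose_mat V'" by auto
  define W where "W = four_block_mat (1\<^sub>m 1) (0\<^sub>m 1 m) (0\<^sub>m m 1) V'"
  have W: "W \<in> carrier_mat n n" using V' n by (auto simp: W_def)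
  have Wt: "transpose_mat W = four_block_mat (1\<^sub>m 1) (0\<^sub>m 1 m) (0\<^sub>m m 1) (transpose_mat V')"
    unfolding W_def using V' by (subst transpose_four_block_mat) auto
  have WW: "transpose_mat W * W = 1\<^sub>m n" "W * transpose_mat W = 1\<^sub>m n"
    using V' n unfolding Wt unfolding W_def
    by (subst mult_four_block_mat[of _ 1 1 _ m _ m _ _ 1 _ m]; simp)+
  have D: "mat_diag n ((!) (e # es)) = four_block_mat (mat 1 1 (\<lambda>_. e)) (0\<^sub>m 1 m) (0\<^sub>m m 1) (mat_diag m ((!) es))"
    by (rule eq_matI) (auto simp: n mat_diag_def)
  have MW: "M = W * mat_diag n ((!) (e # es)) * transpose_mat W"
  proof -
    define D' where "D' = mat_diag m ((!) es)"
    have D': "D' \<in> carrier_mat m m" by (simp add: D'_def mat_diag_def)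
    have "W * mat_diag n ((!) (e # es)) = four_block_mat (mat 1 1 (\<lambda>_. e)) (0\<^sub>m 1 m) (0\<^sub>m m 1) (V' * D')"
      unfolding D D'_def[symmetric] W_def using V'(1) D'
      by (subst mult_four_block_mat[of _ 1 1 _ m _ m _ _ 1 _ m]; simp)
    moreover have "\<dots> * transpose_mat W = M"
      unfolding Wt MB V'(4)[folded D'_def] using V'(1) D'
      by (subst mult_four_block_mat[of _ 1 1 _ m _ m _ _ 1 _ m]; simp)
    ultimately show ?thesis by simp
  qed
  define V where "V = H * W"
  have V: "V \<in> carrier_mat n n" using H W by (simp add: V_def)
  have Vt: "transpose_mat V = transpose_mat W * H"
    using H W by (simp add: V_def transpose_mult[of _ n n _ n])
  have Wt_carr: "transpose_mat W \<in> carrier_mat n n" using W by simp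
  have "transpose_mat V * V = transpose_mat W * ((H * H) * W)"
    unfolding Vt unfolding V_def using H(1) W by (simp add: assoc_mult_mat[of _ n n _ n _ n])
  then have 1: "transpose_mat V * V = 1\<^sub>m n" using H W WW by simp
  have "V * transpose_mat V = H * ((W * transpose_mat W) * H)"
    unfolding Vt unfolding V_def using H(1) W by (simp add: assoc_mult_mat[of _ n n _ n _ n])
  then have 2: "V * transpose_mat V = 1\<^sub>m n" using H W WW by simp
  have Dc: "mat_diag n ((!) (e # es)) \<in> carrier_mat n n" by (simp add: mat_diag_def)
  have "H * M * H = (H * H) * A * (H * H)"
    unfolding M_def using H(1) A by (simp add: assoc_mult_mat[of _ n n _ n _ n])
  then have "A = H * M * H" using H A by simp
  also have "\<dots> = V * mat_diag n ((!) (e # es)) * transpose_mat V"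
    unfolding Vt MW unfolding V_def using H(1) W Wt_carr Dc
    by (simp add: assoc_mult_mat[of _ n n _ n _ n] mult_carrier_mat[of _ n n _ n])
  finally have 3: "A = V * mat_diag n ((!) (e # es)) * transpose_mat V" .
  show ?case
    by (rule bexI[OF _ V], intro conjI 1 2 3)
qed

section \<open>Characteristic polynomials of \<open>X Y\<close> and \<open>Y X\<close>\<close>

text \<open>The determinant of the block matrix \<open>P\<close> with rows \<open>(t I, X)\<close>
  and \<open>(Y, I)\<close> is computed twice. Clearing \<open>Y\<close> by the right factor
  \<open>L\<close> leaves \<open>t I - X Y\<close>; clearing it by the left factor \<open>R\<close>
  leaves \<open>t I - Y X\<close>. The powers of \<open>t\<close> account for the surplus zero
  eigenvalues.\<close>

lemma char_poly_mult_rectangular: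
  fixes X Y :: "'a :: idom mat"
  assumes X: "X \<in> carrier_mat n k" and Y: "Y \<in> carrier_mat k n"
  shows "[:0, 1:] ^ k * char_poly (X * Y) = [:0, 1:] ^ n * char_poly (Y * X)"
proof -
  \<comment> \<open>The entries become constant polynomials, so that all blocks lie over the
    polynomial ring; \<open>T m\<close> is the indeterminate times the identity.\<close>
  define X' where "X' = map_mat (\<lambda>a. [:a:]) X"
  define Y' where "Y' = map_mat (\<lambda>a. [:a:]) Y"
  have X': "X' \<in> carrier_mat n k" and Y': "Y' \<in> carrier_mat k n"
    using X Y by (auto simp: X'_def Y'_def)
  define T where "T m = [:0, 1::'a:] \<cdot>\<^sub>m 1\<^sub>m m" for m
  have T: "T m \<in> carrier_mat m m" and det_T: "det (T m) = [:0, 1:] ^ m" for m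
    by (simp_all add: T_def)
  have T_dim: "dim_row (T m) = m" "dim_col (T m) = m" for m
    by (simp_all add: T_def)
  have const_sum: "[:sum f I:] = (\<Sum>i\<in>I. [:f i:])" for f :: "nat \<Rightarrow> 'a" and I
  proof (induction I rule: infinite_finite_induct)
    case (insert x F)
    have "[:f x + sum f F:] = [:f x:] + [:sum f F:]" by simp
    then show ?case using insert by (simp del: add_pCons)
  qed simp_all
  have XY: "char_poly (X * Y) = det (T n - X' * Y')"
    unfolding char_poly_def
    by (rule arg_cong[of _ _ det], rule eq_matI)
       (use X Y in \<open>auto simp: char_poly_matrix_def T_def X'_def Y'_def scalar_prod_def mult.commute simp flip: const_sum\<close>)
  have YX: "char_poly (Y * X) = det (T k - Y' * X')"
    unfolding char_poly_def
    by (rule arg_cong[of _ _ det], rule eq_matI)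
       (use X Y in \<open>auto simp: char_poly_matrix_def T_def X'_def Y'_def scalar_prod_def mult.commute simp flip: const_sum\<close>)
  define P where "P = four_block_mat (T n) X' Y' (1\<^sub>m k)"
  define L where "L = four_block_mat (1\<^sub>m n) (0\<^sub>m n k) (- Y') (1\<^sub>m k)"
  \<comment> \<open>The corner \<open>T k\<close> scales the second block row by the indeterminate,
    so \<open>Y\<close> is eliminated without dividing by it. The price is the factor
    \<open>det R\<close>, the \<open>k\<close>-th power of the indeterminate.\<close>
  define R where "R = four_block_mat (1\<^sub>m n) (0\<^sub>m n k) (- Y') (T k)"
  have carr: "P \<in> carrier_mat (n + k) (n + k)" "L \<in> carrier_mat (n + k) (n + k)" "R \<in> carrier_mat (n + k) (n + k)"
    using T by (auto simp: P_def L_def R_def)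
  have "P * L = four_block_mat (T n - X' * Y') X' (0\<^sub>m k n) (1\<^sub>m k)"
    unfolding P_def L_def
    by (subst mult_four_block_mat[of _ n n _ k _ k _ _ n _ k])
       (use X' Y' T in \<open>auto intro!: cong_four_block_mat eq_matI simp: right_mult_one_mat[OF T] right_mult_zero_mat[OF T] scalar_prod_def sum_negf\<close>)
  then have "det (P * L) = det (T n - X' * Y')"
    using X' Y' T by (simp add: det_four_block_mat_lower_left_zero[of _ n _ k]
      minus_carrier_mat[OF mult_carrier_mat[OF X' Y']])
  moreover have "det L = 1"
    using Y' by (simp add: L_def det_four_block_mat_upper_right_zero[of _ n _ k])
  ultimately have PXY: "det P = char_poly (X * Y)"
    using det_mult[OF carr(1,2)] by (simp add: XY)
  have comm: "T k * Y' = Y' * T n"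
    using Y' by (intro eq_matI) (auto simp: T_def)
  have "R * P = four_block_mat (T n) X' (0\<^sub>m k n) (T k - Y' * X')"
  proof -
    have "- Y' * T n + T k * Y' = 0\<^sub>m k n"
      unfolding comm uminus_mult_left_mat[of Y' "T n", unfolded T_dim carrier_matD[OF Y'], OF refl]
      using mult_carrier_mat[OF Y' T] by (intro eq_matI) auto
    moreover have "- Y' * X' + T k * 1\<^sub>m k = T k - Y' * X'"
      using X' Y' T by (intro eq_matI) (auto simp: right_mult_one_mat[OF T] T_dim)
    ultimately show ?thesis
      unfolding P_def R_def using X' Y' T
      by (subst mult_four_block_mat[of _ n n _ k _ k _ _ n _ k])
         (simp_all add: left_mult_one_mat[OF T])
  qed
  then have "det (R * P) = [:0, 1:] ^ n * det (T k - Y' * X')"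
    using X' Y' T by (simp add: det_four_block_mat_lower_left_zero[of _ n _ k] det_T
      minus_carrier_mat[OF mult_carrier_mat[OF Y' X']])
  moreover have "det R = [:0, 1:] ^ k"
    using Y' T by (simp add: R_def det_four_block_mat_upper_right_zero[of _ n _ k] det_T)
  ultimately show ?thesis
    using det_mult[OF carr(3,1)] by (simp add: PXY YX)
qed

section \<open>Real spectrum of symmetric matrices and its sorted list\<close>

text \<open>The polynomial splits over the complex numbers. For an eigenvector \<open>v\<close> of a
  root \<open>c\<close>, the Hermitian form \<open>Q\<close> of \<open>A\<close> at \<open>v\<close>
  equals \<open>c\<close> times the squared norm of \<open>v\<close> and is its own conjugate by
  symmetry, so \<open>c\<close> is real. Injectivity of the embedding carries the factorization back
  to the reals.\<close>

lemma real_symmetric_char_poly_factorized: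
  fixes A :: "real mat"
  assumes A: "A \<in> carrier_mat n n" and sym: "transpose_mat A = A"
  shows "\<exists>es. char_poly A = (\<Prod>a\<leftarrow>es. [:- a, 1:])"
proof -
  let ?A = "map_mat complex_of_real A"
  have A': "?A \<in> carrier_mat n n" using A by simp
  obtain cs where cs: "char_poly ?A = (\<Prod>a\<leftarrow>cs. [:- a, 1:])"
    using char_poly_factorized[OF A'] by blast
  have real: "Im c = 0" if "c \<in> set cs" for c
  proof -
    have "poly (char_poly ?A) c = 0"
      unfolding cs poly_prod_list using that by (auto simp: prod_list_zero_iff image_iff)
    then obtain v where v: "v \<in> carrier_vec n" "v \<noteq> 0\<^sub>v n" "?A *\<^sub>v v = c \<cdot>\<^sub>v v"
      using A by (auto simp: eigenvalue_root_char_poly[OF A', symmetric] eigenvalue_def eigenvector_def)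
    define Q where "Q = (\<Sum>i<n. \<Sum>j<n. complex_of_real (A $$ (i, j)) * v $ j * cnj (v $ i))"
    define N where "N = (\<Sum>i<n. (cmod (v $ i))\<^sup>2)"
    have Av: "(\<Sum>j<n. complex_of_real (A $$ (i, j)) * v $ j) = c * v $ i" if "i < n" for i
      using arg_cong[OF v(3), of "\<lambda>x. x $ i"] that v(1) A
      by (simp add: scalar_prod_def atLeast0LessThan)
    have "Q = (\<Sum>i<n. (\<Sum>j<n. complex_of_real (A $$ (i, j)) * v $ j) * cnj (v $ i))"
      by (simp add: Q_def sum_distrib_right)
    also have "\<dots> = (\<Sum>i<n. c * (v $ i * cnj (v $ i)))"
      using Av by (simp add: mult.assoc)
    also have "\<dots> = c * complex_of_real N"
      by (simp add: N_def sum_distrib_left flip: complex_norm_square)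
    finally have Q: "Q = c * complex_of_real N" .
    have symA: "A $$ (i, j) = A $$ (j, i)" if "i < n" "j < n" for i j
      using arg_cong[OF sym, of "\<lambda>x. x $$ (i, j)"] that A by simp
    have "cnj Q = (\<Sum>i<n. \<Sum>j<n. complex_of_real (A $$ (j, i)) * v $ i * cnj (v $ j))"
      using symA by (simp add: Q_def cnj_sum mult_ac)
    also have "\<dots> = Q" unfolding Q_def by (rule sum.swap)
    finally have "cnj Q = Q" .
    then have "cnj c * complex_of_real N = c * complex_of_real N" by (simp add: Q)
    moreover have "N \<noteq> 0"
    proof -
      obtain i where "i < n" "v $ i \<noteq> 0" using v(1,2) by (metis carrier_vecD eq_vecI index_zero_vec)
      then have "N > 0" unfolding N_def by (auto intro: sum_pos2)
      then show ?thesis by simp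
    qed
    ultimately have "cnj c = c" by simp
    then show ?thesis by (metis Im_complex_of_real Reals_cnj_iff Reals_cases)
  qed
  interpret of_real_poly: map_poly_inj_comm_ring_hom "of_real :: real \<Rightarrow> complex" ..
  have "map_poly complex_of_real (char_poly A) = char_poly ?A"
    by (rule of_real_hom.char_poly_hom[OF A, symmetric])
  also have "\<dots> = (\<Prod>a\<leftarrow>map Re cs. [:- complex_of_real a, 1:])"
    unfolding cs map_map o_def
    by (intro arg_cong[of _ _ prod_list] map_cong refl) (simp add: complex_eq_iff real)
  also have "\<dots> = map_poly complex_of_real (\<Prod>a\<leftarrow>map Re cs. [:- a, 1:])"
    by (simp add: of_real_poly.hom_prod_list o_def)
  finally have "char_poly A = (\<Prod>a\<leftarrow>map Re cs. [:- a, 1:])"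
    by simp
  then show ?thesis by blast
qed

text \<open>\<open>proots\<close> collects real roots only, so a full list of eigenvalues rests on
  the splitting over the reals. The sorted list is then a permutation of any list of linear
  factors.\<close>

lemma eigs_symmetric:
  fixes A :: "real mat"
  assumes A: "A \<in> carrier_mat n n" and sym: "transpose_mat A = A"
  shows "length (eigs A) = n"
    and "char_poly A = (\<Prod>a\<leftarrow>eigs A. [:- a, 1:])"
    and "sorted_wrt (\<ge>) (eigs A)"
proof -
  obtain es where es: "char_poly A = (\<Prod>a\<leftarrow>es. [:- a, 1:])"
    using real_symmetric_char_poly_factorized[OF A sym] by blast
  have nz: "(\<Prod>a\<leftarrow>es. [:- a, 1:]) \<noteq> (0 :: real poly)" for es
    by (auto simp: prod_list_zero_iff)
  have "proots (char_poly A) = mset es"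
    unfolding es
  proof (induction es)
    case (Cons a es)
    have "proots ([:- a, 1:] * (\<Prod>a\<leftarrow>es. [:- a, 1:])) = proots [:- a, 1:] + proots (\<Prod>a\<leftarrow>es. [:- a, 1:])"
      by (rule proots_mult) (use nz in auto)
    then show ?case using Cons.IH by (simp only: list.map prod_list.Cons mset.simps) simp
  qed simp
  then have m: "mset (eigs A) = mset es" by (simp add: eigs_def)
  then show cp: "char_poly A = (\<Prod>a\<leftarrow>eigs A. [:- a, 1:])"
    unfolding es by (metis (no_types) mset_map prod_mset_prod_list)
  have "degree (char_poly A) = length (eigs A)"
    unfolding cp using degree_linear_factors[of uminus "eigs A"] by simp
  then show "length (eigs A) = n" using degree_monic_char_poly[OF A] by simp
  show "sorted_wrt (\<ge>) (eigs A)"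
    by (simp add: eigs_def sorted_wrt_rev)
qed

text \<open>For an eigenvector \<open>v\<close>, the quadratic form at \<open>v\<close> is
  \<open>e\<close> times the positive number \<open>v \<bullet> v\<close>.\<close>

lemma eigs_nonneg:
  fixes A :: "real mat"
  assumes "psd_mat A" "e \<in> set (eigs A)"
  shows "e \<ge> 0"
proof -
  define n where "n = dim_row A"
  have A: "A \<in> carrier_mat n n" and sym: "transpose_mat A = A"
    and pos: "\<And>v. v \<in> carrier_vec n \<Longrightarrow> scalar_prod v (A *\<^sub>v v) \<ge> 0"
    using assms(1) by (auto simp: psd_mat_def n_def square_mat.simps)
  have "poly (char_poly A) e = 0"
    unfolding eigs_symmetric(2)[OF A sym] poly_prod_list using assms(2)
    by (auto simp: prod_list_zero_iff image_iff)
  then obtain v where v: "v \<in> carrier_vec n" "v \<noteq> 0\<^sub>v n" "A *\<^sub>v v = e \<cdot>\<^sub>v v"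
    using A by (auto simp: eigenvalue_root_char_poly[OF A, symmetric] eigenvalue_def eigenvector_def)
  have "scalar_prod v v = (\<Sum>i<n. (v $ i)\<^sup>2)"
    using v(1) by (simp add: scalar_prod_def atLeast0LessThan power2_eq_square)
  moreover obtain i where "i < n" "v $ i \<noteq> 0" using v(1,2) by (metis carrier_vecD eq_vecI index_zero_vec)
  ultimately have "scalar_prod v v > 0" by (auto intro: sum_pos2)
  moreover have "e * scalar_prod v v \<ge> 0" using pos[OF v(1)] v by simp
  ultimately show ?thesis by (simp add: zero_le_mult_iff)
qed

section \<open>Second moment of a centred Bernoulli sum\<close>

text \<open>The variables \<open>of_bool (f i) / p - 1\<close> are independent with mean 0 and
  variance \<open>1 / p - 1\<close>, so cross terms vanish. The shift \<open>b\<close> makes the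
  induction work: once one coordinate is fixed, its term is absorbed into \<open>b\<close>.\<close>

lemma expectation_sq_sum_centered_Pi_bernoulli:
  fixes p :: real
  assumes "finite I" and p: "0 < p" "p \<le> 1"
  shows "measure_pmf.expectation (Pi_pmf I False (\<lambda>_. bernoulli_pmf p))
           (\<lambda>f. (b + (\<Sum>i\<in>I. a i * (of_bool (f i) / p - 1)))\<^sup>2)
         = b\<^sup>2 + (1 / p - 1) * (\<Sum>i\<in>I. (a i)\<^sup>2)"
  using assms(1)
proof (induction I arbitrary: b)
  case empty
  then show ?case by simp
next
  case (insert x I)
  let ?P = "\<lambda>I. Pi_pmf I False (\<lambda>_. bernoulli_pmf p)"
  let ?h = "\<lambda>f. (b + (\<Sum>i\<in>insert x I. a i * (of_bool (f i) / p - 1)))\<^sup>2"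
  have fin: "finite (set_pmf (?P I))"
    by (rule finite_subset[OF set_Pi_pmf_subset'[OF insert(1)]])
       (use insert(1) in \<open>auto intro: finite_PiE_dflt\<close>)
  have inner: "measure_pmf.expectation (map_pmf (\<lambda>f. f(x := y)) (?P I)) ?h
      = (b + a x * (of_bool y / p - 1))\<^sup>2 + (1 / p - 1) * (\<Sum>i\<in>I. (a i)\<^sup>2)" for y
  proof -
    have "(\<Sum>i\<in>I. a i * (of_bool ((f(x := y)) i) / p - 1)) = (\<Sum>i\<in>I. a i * (of_bool (f i) / p - 1))" for f
      using insert(2) by (intro sum.cong) auto
    then have "measure_pmf.expectation (map_pmf (\<lambda>f. f(x := y)) (?P I)) ?h
        = measure_pmf.expectation (?P I)
           (\<lambda>f. (b + a x * (of_bool y / p - 1) + (\<Sum>i\<in>I. a i * (of_bool (f i) / p - 1)))\<^sup>2)"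
      using insert(1,2) by (simp add: add.assoc)
    then show ?thesis by (simp only: insert.IH)
  qed
  have "?P (insert x I) = bernoulli_pmf p \<bind> (\<lambda>y. map_pmf (\<lambda>f. f(x := y)) (?P I))"
    using insert by (simp add: Pi_pmf_insert' map_pmf_def)
  then have "measure_pmf.expectation (?P (insert x I)) ?h
      = (\<Sum>y\<in>UNIV. pmf (bernoulli_pmf p) y *\<^sub>R measure_pmf.expectation (map_pmf (\<lambda>f. f(x := y)) (?P I)) ?h)"
    using fin by (simp only:) (rule pmf_expectation_bind, auto)
  also have "\<dots> = b\<^sup>2 + (1 / p - 1) * ((a x)\<^sup>2 + (\<Sum>i\<in>I. (a i)\<^sup>2))"
    unfolding inner using p by (simp add: UNIV_bool field_simps power2_eq_square)
  finally show ?case using insert by simp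
qed

section \<open>Deterministic bound on the eigenvalue error\<close>

lemma diag_congruence_index:
  fixes V :: "'a :: comm_semiring_1 mat"
  assumes V: "V \<in> carrier_mat n n" and ij: "i < n" "j < n"
  shows "(V * mat_diag n d * transpose_mat V) $$ (i, j) = (\<Sum>k<n. V $$ (i, k) * d k * V $$ (j, k))"
  unfolding mat_diag_mult_right[OF V] using V ij
  by (simp add: scalar_prod_def atLeast0LessThan)

lemma gram_psd_mat:
  fixes C :: "real mat"
  assumes C: "C \<in> carrier_mat n k"
  shows "psd_mat (transpose_mat C * C)"
proof -
  have "scalar_prod v ((transpose_mat C * C) *\<^sub>v v) \<ge> 0" if v: "v \<in> carrier_vec k" for v
  proof -
    have "(transpose_mat C * C) *\<^sub>v v = transpose_mat C *\<^sub>v (C *\<^sub>v v)"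
      using C v by (intro assoc_mult_mat_vec) auto
    then have "scalar_prod v ((transpose_mat C * C) *\<^sub>v v) = scalar_prod (C *\<^sub>v v) (C *\<^sub>v v)"
      using C v transpose_vec_mult_scalar[OF C v, of "C *\<^sub>v v"]
      by (simp add: comm_scalar_prod[of v k])
    also have "\<dots> \<ge> 0" by (simp add: scalar_prod_def sum_nonneg)
    finally show ?thesis .
  qed
  then show ?thesis
    using C by (simp add: psd_mat_def square_mat.simps transpose_mult[of _ k n _ k])
qed

text \<open>The rescaled Gram matrix \<open>c Y\<close> of the sampled columns of \<open>B\<close>
  has the estimates as its sorted eigenvalues, zeros included. Hoffman-Wielandt compares it with the
  diagonal matrix \<open>B B^T\<close> of the eigenvalues of \<open>A\<close>, and the entries of
  the difference are, up to sign, the centred sums on the right.\<close>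

lemma eig_l2_error_le:
  fixes A :: "real mat" and B :: "nat \<Rightarrow> nat \<Rightarrow> real"
  assumes A: "A \<in> carrier_mat n n" and sym: "transpose_mat A = A"
    and s: "0 < s" and S: "S \<subseteq> {..<n}"
    and AB: "\<And>i j. i < n \<Longrightarrow> j < n \<Longrightarrow> A $$ (i, j) = (\<Sum>k<n. B k i * B k j)"
    and BB: "\<And>k l. k < n \<Longrightarrow> l < n \<Longrightarrow> (\<Sum>i<n. B k i * B l i) = of_bool (k = l) * eigs A ! k"
  shows "(eig_l2_error A s S)\<^sup>2
       \<le> (\<Sum>r<n. \<Sum>t<n. (\<Sum>i<n. B r i * B t i * (of_bool (i \<in> S) / (s / real n) - 1))\<^sup>2)"
proof -
  define k where "k = card S"
  have fin: "finite S" using S finite_subset by blast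
  have kn: "k \<le> n" using card_mono[OF _ S] by (simp add: k_def)
  have S_eq: "{i. i < n \<and> i \<in> S} = S" using S by auto
  have pick_S: "pick S c \<in> S" if "c < k" for c
    using that by (simp add: k_def pick_in_set_le)
  have pick_n: "pick S c < n" if "c < k" for c
    using pick_S[OF that] S by auto
  \<comment> \<open>\<open>submatrix\<close> numbers its rows and columns through
    \<open>pick S\<close>. That this is a bijection onto \<open>S\<close> turns sums over the
    columns of \<open>C\<close> into sums over \<open>S\<close>.\<close>
  have "inj_on (pick S) {..<k}"
    by (rule linorder_inj_onI) (use pick_mono_le[of _ S] in \<open>auto simp: k_def less_le\<close>)
  moreover from this have "pick S ` {..<k} = S"
    using pick_S fin by (intro card_subset_eq) (auto simp: card_image k_def)
  ultimately have bij: "bij_betw (pick S) {..<k} S" by (simp add: bij_betw_def)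
  define C where "C = mat n k (\<lambda>(r, c). B r (pick S c))"
  have C: "C \<in> carrier_mat n k" by (simp add: C_def)
  define Y where "Y = C * transpose_mat C"
  have Y: "Y \<in> carrier_mat n n" using C by (simp add: Y_def)
  have symY: "transpose_mat Y = Y"
    using C by (simp add: Y_def transpose_mult[of _ n k _ n])
  have Y_index: "Y $$ (r, t) = (\<Sum>i\<in>S. B r i * B t i)" if "r < n" "t < n" for r t
  proof -
    have "Y $$ (r, t) = (\<Sum>c<k. B r (pick S c) * B t (pick S c))"
      using that by (simp add: Y_def C_def scalar_prod_def atLeast0LessThan)
    also have "\<dots> = (\<Sum>i\<in>S. B r i * B t i)"
      by (rule sum.reindex_bij_betw[OF bij])
    finally show ?thesis .
  qed
  define AS where "AS = submatrix A S S"
  have AS: "AS \<in> carrier_mat k k"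
    using A by (simp add: AS_def submatrix_def S_eq k_def)
  have AS_gram: "AS = transpose_mat C * C"
  proof (rule eq_matI)
    fix i j assume "i < dim_row (transpose_mat C * C)" "j < dim_col (transpose_mat C * C)"
    then have ij: "i < k" "j < k" using C by auto
    then have "AS $$ (i, j) = A $$ (pick S i, pick S j)"
      using A by (simp add: AS_def submatrix_index S_eq k_def)
    also have "\<dots> = (transpose_mat C * C) $$ (i, j)"
      using ij pick_n by (simp add: AB C_def scalar_prod_def atLeast0LessThan)
    finally show "AS $$ (i, j) = (transpose_mat C * C) $$ (i, j)" .
  qed (use AS C in auto)
  have psd: "psd_mat AS" unfolding AS_gram by (rule gram_psd_mat[OF C])
  then have symAS: "transpose_mat AS = AS" by (simp add: psd_mat_def)
  note eAS = eigs_symmetric[OF AS symAS]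
  \<comment> \<open>The spectrum of the \<open>n \<times> n\<close> matrix \<open>Y\<close> is that of the submatrix, padded with zeros.\<close>
  define \<mu> where "\<mu> = eigs AS @ replicate (n - k) 0"
  have len: "length \<mu> = n" using eAS(1) kn by (simp add: \<mu>_def)
  have "[:0, 1:] ^ k * char_poly Y = [:0, 1:] ^ n * char_poly AS"
    unfolding Y_def AS_gram using C by (intro char_poly_mult_rectangular) auto
  also have "\<dots> = [:0, 1:] ^ k * ([:0, 1:] ^ (n - k) * char_poly AS)"
    using kn by (simp flip: power_add mult.assoc)
  finally have "char_poly Y = [:0, 1:] ^ (n - k) * char_poly AS"
    by (subst (asm) mult_cancel_left) simp
  also have "\<dots> = (\<Prod>a\<leftarrow>\<mu>. [:- a, 1:])"
    by (simp add: \<mu>_def eAS(2)[symmetric] prod_list_replicate mult.commute)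
  finally obtain V where V: "V \<in> carrier_mat n n" "transpose_mat V * V = 1\<^sub>m n"
    "V * transpose_mat V = 1\<^sub>m n" "Y = V * mat_diag n ((!) \<mu>) * transpose_mat V"
    using real_symmetric_spectral[OF Y symY] by blast
  \<comment> \<open>Zeros may be appended at the end without breaking the order because the
    submatrix has no negative eigenvalue.\<close>
  have "sorted_wrt (\<ge>) (replicate m (0 :: real))" for m by (induction m) auto
  moreover have "\<forall>e\<in>set (eigs AS). e \<ge> 0" using eigs_nonneg[OF psd] by blast
  ultimately have sorted_\<mu>: "sorted_wrt (\<ge>) \<mu>"
    using eAS(3) by (auto simp: \<mu>_def sorted_wrt_append)
  note eA = eigs_symmetric[OF A sym]
  have antimono: "xs ! j \<le> xs ! i" if "sorted_wrt (\<ge>) xs" "length xs = n" "i \<le> j" "j < n"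
    for xs :: "real list" and i j
    using that sorted_wrt_nth_less[of "(\<ge>)" xs i j] by (cases "i = j") auto
  define c where "c = 1 / (s / real n)"
  have c: "c \<ge> 0" using s by (simp add: c_def)
  \<comment> \<open>Up to position \<open>k\<close> the sign test in \<open>est_eig\<close> holds by
    positive semidefiniteness; beyond it the default 0 agrees with the padding of
    \<open>\<mu>\<close>. Estimates are numbered from 1, list entries from 0.\<close>
  have est: "est_eig A s S (Suc i) = c * \<mu> ! i" if "i < n" for i
  proof (cases "i < k")
    case True
    then have "eig AS (Suc i) = eigs AS ! i" "eigs AS ! i \<ge> 0"
      using eigs_nonneg[OF psd, of "eigs AS ! i"] eAS(1) by (simp_all add: eig_def)
    then show ?thesis
      using True A eAS(1) by (simp add: est_eig_def AS_def[symmetric] \<mu>_def k_def[symmetric] nth_append c_def)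
  next
    case False
    then show ?thesis
      using that eAS(1) by (simp add: est_eig_def \<mu>_def k_def[symmetric] nth_append)
  qed
  have "(eig_l2_error A s S)\<^sup>2 = (\<Sum>i = 1..n. (est_eig A s S i - eig A i)\<^sup>2)"
    using A by (simp add: eig_l2_error_def sum_nonneg)
  also have "\<dots> = (\<Sum>i<n. (est_eig A s S (Suc i) - eig A (Suc i))\<^sup>2)"
    by (simp add: sum.atLeast1_atMost_eq)
  also have "\<dots> = (\<Sum>i<n. (eigs A ! i - c * \<mu> ! i)\<^sup>2)"
    by (intro sum.cong) (simp_all add: est eig_def power2_commute)
  also have "\<dots> \<le> (\<Sum>r<n. \<Sum>t<n. (of_bool (r = t) * eigs A ! r - c * Y $$ (r, t))\<^sup>2)"
  proof (rule hoffman_wielandt_diagonal[where V = "\<lambda>i j. V $$ (i, j)"])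
    show "eigs A ! j \<le> eigs A ! i" if "i \<le> j" "j < n" for i j
      using antimono[OF eA(3,1)] that by blast
    show "c * \<mu> ! j \<le> c * \<mu> ! i" if "i \<le> j" "j < n" for i j
      using antimono[OF sorted_\<mu> len] that c by (intro mult_left_mono) auto
    show "(\<Sum>k<n. V $$ (i, k) * V $$ (j, k)) = of_bool (i = j)" if "i < n" "j < n" for i j
      using arg_cong[OF V(3), of "\<lambda>M. M $$ (i, j)"] that V(1)
      by (simp add: scalar_prod_def atLeast0LessThan)
    show "(\<Sum>k<n. V $$ (k, i) * V $$ (k, j)) = of_bool (i = j)" if "i < n" "j < n" for i j
      using arg_cong[OF V(2), of "\<lambda>M. M $$ (i, j)"] that V(1)
      by (simp add: scalar_prod_def atLeast0LessThan)
    show "c * Y $$ (i, j) = (\<Sum>k<n. V $$ (i, k) * (c * \<mu> ! k) * V $$ (j, k))" if "i < n" "j < n" for i j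
      unfolding V(4) diag_congruence_index[OF V(1) that] by (simp add: sum_distrib_left mult_ac)
  qed
  also have "\<dots> = (\<Sum>r<n. \<Sum>t<n. (\<Sum>i<n. B r i * B t i * (of_bool (i \<in> S) / (s / real n) - 1))\<^sup>2)"
  proof (intro sum.cong refl)
    fix r t assume "r \<in> {..<n}" "t \<in> {..<n}"
    then have rt: "r < n" "t < n" by auto
    have "(\<Sum>i\<in>S. B r i * B t i) = (\<Sum>i<n. B r i * B t i * of_bool (i \<in> S))"
      using S by (intro sum.mono_neutral_cong_left) auto
    then have "c * Y $$ (r, t) - of_bool (r = t) * eigs A ! r
        = c * (\<Sum>i<n. B r i * B t i * of_bool (i \<in> S)) - (\<Sum>i<n. B r i * B t i)"
      using Y_index[OF rt] BB[OF rt] by simp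
    also have "\<dots> = (\<Sum>i<n. B r i * B t i * (of_bool (i \<in> S) / (s / real n) - 1))"
      unfolding sum_distrib_left sum_subtractf[symmetric]
      by (intro sum.cong) (simp_all add: c_def algebra_simps)
    finally show "(of_bool (r = t) * eigs A ! r - c * Y $$ (r, t))\<^sup>2
        = (\<Sum>i<n. B r i * B t i * (of_bool (i \<in> S) / (s / real n) - 1))\<^sup>2"
      by (simp only: power2_commute[of "of_bool (r = t) * eigs A ! r"])
  qed
  finally show ?thesis .
qed

section \<open>Expected sampling error and Markov's inequality\<close>

text \<open>By the second moment formula each entry contributes \<open>1 / p - 1\<close> times a sum
  of \<open>(B r i * B t i)^2\<close>. Summed over \<open>r\<close> and \<open>t\<close>, these
  factor into the square of the squared norm of column \<open>i\<close>, which is at most 1.\<close>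

lemma expectation_sampling_error:
  fixes B :: "nat \<Rightarrow> nat \<Rightarrow> real" and p :: real
  assumes p: "0 < p" "p \<le> 1"
    and B: "\<And>i. i < n \<Longrightarrow> (\<Sum>r<n. (B r i)\<^sup>2) \<le> 1"
  shows "measure_pmf.expectation (Pi_pmf {..<n} False (\<lambda>_. bernoulli_pmf p))
           (\<lambda>f. \<Sum>r<n. \<Sum>t<n. (\<Sum>i<n. B r i * B t i * (of_bool (f i) / p - 1))\<^sup>2) \<le> n / p"
proof -
  let ?P = "Pi_pmf {..<n} False (\<lambda>_. bernoulli_pmf p)"
  have fin: "finite (set_pmf ?P)" by (auto simp: set_Pi_pmf)
  have "measure_pmf.expectation ?P (\<lambda>f. \<Sum>r<n. \<Sum>t<n. (\<Sum>i<n. B r i * B t i * (of_bool (f i) / p - 1))\<^sup>2)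
      = (\<Sum>r<n. \<Sum>t<n. measure_pmf.expectation ?P (\<lambda>f. (\<Sum>i<n. B r i * B t i * (of_bool (f i) / p - 1))\<^sup>2))"
    using fin by (simp add: integrable_measure_pmf_finite)
  also have "\<dots> = (\<Sum>r<n. \<Sum>t<n. (1 / p - 1) * (\<Sum>i<n. (B r i * B t i)\<^sup>2))"
    using expectation_sq_sum_centered_Pi_bernoulli[of "{..<n}" p 0] p by simp
  also have "\<dots> = (1 / p - 1) * (\<Sum>r<n. \<Sum>t<n. \<Sum>i<n. (B r i)\<^sup>2 * (B t i)\<^sup>2)"
    by (simp add: sum_distrib_left power_mult_distrib)
  also have "(\<Sum>r<n. \<Sum>t<n. \<Sum>i<n. (B r i)\<^sup>2 * (B t i)\<^sup>2) = (\<Sum>r<n. \<Sum>i<n. \<Sum>t<n. (B r i)\<^sup>2 * (B t i)\<^sup>2)"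
    by (intro sum.cong refl sum.swap)
  also have "\<dots> = (\<Sum>i<n. \<Sum>r<n. \<Sum>t<n. (B r i)\<^sup>2 * (B t i)\<^sup>2)"
    by (rule sum.swap)
  also have "\<dots> = (\<Sum>i<n. (\<Sum>r<n. (B r i)\<^sup>2)\<^sup>2)"
    by (simp add: power2_eq_square[of "sum _ _"] sum_product)
  also have "(1 / p - 1) * \<dots> \<le> (1 / p - 1) * (\<Sum>i<n. 1)"
    using p B by (intro mult_left_mono sum_mono power_le_one sum_nonneg) auto
  also have "\<dots> \<le> n / p" using p by (simp add: field_simps)
  finally show ?thesis .
qed

theorem corollary2:
  fixes A :: "real mat" and n :: nat and s \<epsilon> \<delta> :: real
  assumes "A \<in> carrier_mat n n" and "psd_mat A" and "max_entry_norm A \<le> 1"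
    and "0 < \<epsilon>" and "\<epsilon> < 1" and "0 < \<delta>" and "\<delta> < 1"
    and "0 < s" and "s \<le> real n" and "s \<ge> 2 / (\<epsilon>\<^sup>2 * \<delta>)"
  shows "measure_pmf.prob (random_subset n (s / real n))
           {S. eig_l2_error A s S \<le> \<epsilon> * real n} \<ge> 1 - \<delta>
       \<and> (\<forall>S \<subseteq> {..<n}. eig_l2_error A s S \<le> \<epsilon> * real n \<longrightarrow>
            (\<forall>i \<in> {1..n}. eig A i - \<epsilon> * real n \<le> est_eig A s S i
                        \<and> est_eig A s S i \<le> eig A i + \<epsilon> * real n))"
proof (intro conjI allI impI ballI)
  note A = assms(1)
  have n: "n > 0" using assms(8,9) by (cases n) auto
  have sym: "transpose_mat A = A" using assms(2) by (simp add: psd_mat_def)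
  note eA = eigs_symmetric[OF A sym]
  obtain V where V: "V \<in> carrier_mat n n" "transpose_mat V * V = 1\<^sub>m n"
    "A = V * mat_diag n ((!) (eigs A)) * transpose_mat V"
    using real_symmetric_spectral[OF A sym eA(2)] by blast
  define B where "B k i = sqrt (eigs A ! k) * V $$ (i, k)" for k i
  have nonneg: "eigs A ! k \<ge> 0" if "k < n" for k
    using eigs_nonneg[OF assms(2)] eA(1) that by simp
  have AB: "A $$ (i, j) = (\<Sum>k<n. B k i * B k j)" if "i < n" "j < n" for i j
  proof -
    have "A $$ (i, j) = (\<Sum>k<n. V $$ (i, k) * eigs A ! k * V $$ (j, k))"
      using V(3) diag_congruence_index[OF V(1) that] by metis
    also have "\<dots> = (\<Sum>k<n. B k i * B k j)"
    proof (intro sum.cong refl)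
      fix k assume "k \<in> {..<n}"
      then have "sqrt (eigs A ! k) * sqrt (eigs A ! k) = eigs A ! k" using nonneg by simp
      then show "V $$ (i, k) * eigs A ! k * V $$ (j, k) = B k i * B k j"
        unfolding B_def by (metis mult.assoc mult.commute)
    qed
    finally show ?thesis .
  qed
  have BB: "(\<Sum>i<n. B k i * B l i) = of_bool (k = l) * eigs A ! k" if "k < n" "l < n" for k l
  proof -
    have "(\<Sum>i<n. V $$ (i, k) * V $$ (i, l)) = of_bool (k = l)"
      using arg_cong[OF V(2), of "\<lambda>M. M $$ (k, l)"] that V(1)
      by (simp add: scalar_prod_def atLeast0LessThan)
    moreover have "(\<Sum>i<n. B k i * B l i)
        = sqrt (eigs A ! k) * sqrt (eigs A ! l) * (\<Sum>i<n. V $$ (i, k) * V $$ (i, l))"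
      by (simp add: B_def sum_distrib_left mult_ac)
    ultimately show ?thesis using nonneg that by simp
  qed
  \<comment> \<open>The squared norm of column \<open>i\<close> of \<open>B\<close> is the diagonal
    entry \<open>A $$ (i, i)\<close>; the entrywise bound on \<open>A\<close> controls it.\<close>
  have diag: "(\<Sum>r<n. (B r i)\<^sup>2) \<le> 1" if "i < n" for i
  proof -
    have "A $$ (i, i) \<in> elements_mat A" using A that by auto
    moreover have "finite (elements_mat A)" by (simp add: elements_mat_def)
    ultimately have "\<bar>A $$ (i, i)\<bar> \<le> max_entry_norm A"
      unfolding max_entry_norm_def by (intro Max_ge) auto
    then show ?thesis using AB[OF that that] assms(3) by (simp add: power2_eq_square)
  qed
  define p where "p = s / real n"
  have p: "0 < p" "p \<le> 1" using assms(8,9) n by (simp_all add: p_def)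
  let ?P = "Pi_pmf {..<n} False (\<lambda>_. bernoulli_pmf p)"
  define F where "F f = (\<Sum>r<n. \<Sum>t<n. (\<Sum>i<n. B r i * B t i * (of_bool (f i) / p - 1))\<^sup>2)" for f
  have F: "(eig_l2_error A s {i \<in> {..<n}. f i})\<^sup>2 \<le> F f" for f
  proof -
    have "(eig_l2_error A s {i \<in> {..<n}. f i})\<^sup>2 \<le> (\<Sum>r<n. \<Sum>t<n.
        (\<Sum>i<n. B r i * B t i * (of_bool (i \<in> {i \<in> {..<n}. f i}) / (s / real n) - 1))\<^sup>2)"
      by (intro eig_l2_error_le A sym assms(8) AB BB) auto
    also have "\<dots> = F f" by (simp add: F_def p_def)
    finally show ?thesis .
  qed
  have fin: "finite (set_pmf ?P)" by (auto simp: set_Pi_pmf)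
  \<comment> \<open>Since \<open>n / p = n^2 / s\<close>, the bound from Markov's inequality at
    threshold \<open>(\<epsilon> * n)^2\<close> is \<open>1 / (s * \<epsilon>^2)\<close>, which the
    lower bound on \<open>s\<close> keeps at most \<open>\<delta>\<close>.\<close>
  have "1 \<le> s * \<epsilon>\<^sup>2 * \<delta>" using assms(4,6,10) by (simp add: field_simps)
  then have "n / p / (\<epsilon> * n)\<^sup>2 \<le> \<delta>"
    using assms(4,8) n by (simp add: p_def power2_eq_square field_simps)
  moreover have "measure_pmf.expectation ?P F \<le> n / p"
    unfolding F_def by (rule expectation_sampling_error[OF p diag])
  then have "measure_pmf.expectation ?P F / (\<epsilon> * n)\<^sup>2 \<le> n / p / (\<epsilon> * n)\<^sup>2"
    by (intro divide_right_mono) auto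
  moreover have "measure_pmf.prob ?P {f \<in> space ?P. F f \<ge> (\<epsilon> * n)\<^sup>2}
      \<le> measure_pmf.expectation ?P F / (\<epsilon> * n)\<^sup>2"
    by (rule integral_Markov_inequality_measure[where A = "{}"])
       (use fin assms(4) n in \<open>auto simp: integrable_measure_pmf_finite F_def sum_nonneg\<close>)
  ultimately have Markov: "measure_pmf.prob ?P {f. F f \<ge> (\<epsilon> * n)\<^sup>2} \<le> \<delta>" by simp
  \<comment> \<open>\<open>F\<close> only dominates the squared error, so the complement of the
    Markov event is contained in the good event, and monotonicity of the measure finishes.\<close>
  have "- {f. F f \<ge> (\<epsilon> * n)\<^sup>2} \<subseteq> {f. eig_l2_error A s {i \<in> {..<n}. f i} \<le> \<epsilon> * n}"
  proof
    fix f assume "f \<in> - {f. F f \<ge> (\<epsilon> * n)\<^sup>2}"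
    then have "(eig_l2_error A s {i \<in> {..<n}. f i})\<^sup>2 \<le> (\<epsilon> * n)\<^sup>2" using F[of f] by simp
    then show "f \<in> {f. eig_l2_error A s {i \<in> {..<n}. f i} \<le> \<epsilon> * n}"
      using assms(4) by (auto intro: power2_le_imp_le)
  qed
  then have "measure_pmf.prob ?P (- {f. F f \<ge> (\<epsilon> * n)\<^sup>2})
      \<le> measure_pmf.prob ?P {f. eig_l2_error A s {i \<in> {..<n}. f i} \<le> \<epsilon> * n}"
    by (intro measure_pmf.finite_measure_mono) auto
  then show "1 - \<delta> \<le> measure_pmf.prob (random_subset n (s / real n)) {S. eig_l2_error A s S \<le> \<epsilon> * real n}"
    using Markov measure_pmf.prob_compl[of "{f. F f \<ge> (\<epsilon> * n)\<^sup>2}" ?P]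
    by (simp add: random_subset_def p_def vimage_def Compl_eq_Diff_UNIV)
next
  fix S i assume S: "eig_l2_error A s S \<le> \<epsilon> * real n" and i: "i \<in> {1..n}"
  \<comment> \<open>A single squared deviation is one term of the nonnegative sum, so the bound in
    the Euclidean norm gives the bound for every index.\<close>
  have "\<bar>est_eig A s S i - eig A i\<bar>\<^sup>2 \<le> (\<Sum>i = 1..n. \<bar>est_eig A s S i - eig A i\<bar>\<^sup>2)"
    by (rule member_le_sum[OF i]) auto
  then have "sqrt (\<bar>est_eig A s S i - eig A i\<bar>\<^sup>2) \<le> eig_l2_error A s S"
    using assms(1) unfolding eig_l2_error_def by (intro real_sqrt_le_mono) auto
  then have *: "\<bar>est_eig A s S i - eig A i\<bar> \<le> \<epsilon> * real n" using S by simp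
  then show "eig A i - \<epsilon> * real n \<le> est_eig A s S i" by linarith
  show "est_eig A s S i \<le> eig A i + \<epsilon> * real n" using * by linarith
qed

end
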